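(* Let $m, n \geq 4$ be even integers. Then there exists a shiftable $SMA(m,n)$ such that for every $x \in \{1, 2, 3, \ldots, mn/2\}$ the entries $x$ and $-x$ appear in the same row.
   Context: For positive integers $m,n$ with $mn$ even, a (tight) signed magic array $SMA(m,n)$ is an $m \times n$ array with no empty cells whose entries are the elements of $X=\{\pm 1, \pm 2, \ldots, \pm mn/2\}$, each element of $X$ appearing exactly once, such that the entries of every row and of every column sum to $0$. An $SMA(m,n)$ is called shiftable if every row and every column contains the same number of positive entries as negative entries. *)

theory Defs
  imports Main
begin

text \<open>
  An m x n array of integers is a function A of type \<^typ>\<open>nat \<Rightarrow> nat \<Rightarrow> int\<close> of which only the
  values A i j with i < m (row index) and j < n (column index) matter.
\<close>

definition sma_entries :: "nat \<Rightarrow> nat \<Rightarrow> int set" where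
  "sma_entries m n = {x. 1 \<le> \<bar>x\<bar> \<and> \<bar>x\<bar> \<le> int (m * n div 2)}"

definition SMA :: "nat \<Rightarrow> nat \<Rightarrow> (nat \<Rightarrow> nat \<Rightarrow> int) \<Rightarrow> bool" where
  "SMA m n A \<longleftrightarrow>
     m > 0 \<and> n > 0 \<and> even (m * n) \<and>
     bij_betw (\<lambda>(i, j). A i j) ({..<m} \<times> {..<n}) (sma_entries m n) \<and>
     (\<forall>i<m. (\<Sum>j<n. A i j) = 0) \<and>
     (\<forall>j<n. (\<Sum>i<m. A i j) = 0)"

definition shiftable :: "nat \<Rightarrow> nat \<Rightarrow> (nat \<Rightarrow> nat \<Rightarrow> int) \<Rightarrow> bool" where
  "shiftable m n A \<longleftrightarrow>
     (\<forall>i<m. card {j. j < n \<and> A i j > 0} = card {j. j < n \<and> A i j < 0}) \<and>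
     (\<forall>j<n. card {i. i < m \<and> A i j > 0} = card {i. i < m \<and> A i j < 0})"

end

theory Submission
  imports Defs
begin

text \<open>
  A balanced array stays balanced, with the same row and column sums, when every entry is moved
  away from zero by the same amount. Hence two arrays can be placed side by side, or on top of each
  other, after shifting the entries of the second one past those of the first.
  Copies of a \<open>4 \<times> 2\<close> array thus give all arrays with four rows, and copies of a \<open>6 \<times> 4\<close>
  and a \<open>6 \<times> 6\<close> array give all those with six rows; these are then stacked. The \<open>6 \<times> 6\<close>
  array is needed because no \<open>6 \<times> 2\<close> array exists: the sum \<open>1 + \<dots> + 6\<close> is odd.
\<close>

text \<open>Counting signs by a sum of \<open>sgn\<close> makes both conditions additive, which
  suits shifting and concatenation.\<close>

definition balanced :: "nat \<Rightarrow> (nat \<Rightarrow> int) \<Rightarrow> bool" where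
  "balanced k f \<longleftrightarrow> (\<Sum>i<k. f i) = 0 \<and> (\<Sum>i<k. sgn (f i)) = 0"

definition shift :: "int \<Rightarrow> int \<Rightarrow> int" where
  "shift c x = x + c * sgn x"

definition paired_array :: "nat \<Rightarrow> nat \<Rightarrow> (nat \<Rightarrow> nat \<Rightarrow> int) \<Rightarrow> bool" where
  "paired_array m n A \<longleftrightarrow>
     even (m * n) \<and> (\<forall>i<m. balanced n (A i)) \<and> (\<forall>j<n. balanced m (\<lambda>i. A i j)) \<and>
     (\<forall>x \<in> {1..int (m * n div 2)}. \<exists>i<m. (\<exists>j<n. A i j = x) \<and> (\<exists>j<n. A i j = - x))"

lemma paired_array_entries:
  assumes "paired_array m n A" "1 \<le> x" "x \<le> int (m * n div 2)"
  obtains i j k where "i < m" "j < n" "A i j = x" "k < n" "A i k = - x"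
proof -
  have "x \<in> {1..int (m * n div 2)}"
    using assms by simp
  with assms(1) have "\<exists>i<m. (\<exists>j<n. A i j = x) \<and> (\<exists>j<n. A i j = - x)"
    unfolding paired_array_def by (elim conjE) (rule bspec)
  with that show thesis by blast
qed

lemma balanced_signs:
  assumes "balanced k f"
  shows "card {i. i < k \<and> f i > 0} = card {i. i < k \<and> f i < 0}"
proof -
  \<comment> \<open>Prefixes of a balanced sequence need not be balanced, so the induction runs on
    the difference of the two counts.\<close>
  have *: "int (card {i. i < l \<and> f i > 0}) - int (card {i. i < l \<and> f i < 0}) = (\<Sum>i<l. sgn (f i))" for l
  proof (induction l)
    case (Suc l)
    have "{i. i < Suc l \<and> f i > 0} = (if f l > 0 then insert l {i. i < l \<and> f i > 0} else {i. i < l \<and> f i > 0})"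
      and "{i. i < Suc l \<and> f i < 0} = (if f l < 0 then insert l {i. i < l \<and> f i < 0} else {i. i < l \<and> f i < 0})"
      by (auto simp: less_Suc_eq)
    with Suc show ?case
      by (simp add: sgn_if)
  qed simp
  from *[of k] assms show ?thesis
    by (simp add: balanced_def)
qed

lemma sgn_shift: "0 \<le> c \<Longrightarrow> sgn (shift c x) = sgn x"
  by (auto simp: shift_def sgn_if)

text \<open>Shifting changes the sum by \<open>c\<close> times the sum of the signs, which is
  0.\<close>

lemma balanced_shift:
  assumes "balanced k f" "0 \<le> c"
  shows "balanced k (\<lambda>i. shift c (f i))"
proof -
  have "(\<Sum>i<k. shift c (f i)) = (\<Sum>i<k. f i) + c * (\<Sum>i<k. sgn (f i))"
    by (simp add: shift_def sum.distrib sum_distrib_left)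
  with assms show ?thesis
    by (simp add: balanced_def sgn_shift)
qed

lemma balanced_append:
  assumes "balanced k f" "balanced l g"
  shows "balanced (k + l) (\<lambda>i. if i < k then f i else g (i - k))"
proof -
  \<comment> \<open>Taking \<open>h\<close> as the identity and as \<open>sgn\<close> gives the two
    halves of \<open>balanced\<close>.\<close>
  have "(\<Sum>i<k + l. h (if i < k then f i else g (i - k))) = (\<Sum>i<k. h (f i)) + (\<Sum>i<l. h (g i))"
    for h :: "int \<Rightarrow> int"
    by (induction l) auto
  from this[of "\<lambda>x. x"] this[of sgn] assms show ?thesis
    by (simp add: balanced_def)
qed

text \<open>\<open>A\<close> supplies the absolute values up to \<open>c\<close>, the shifted
  \<open>B\<close> those beyond \<open>c\<close>. Pairs stay together because rows are only
  extended.\<close>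

lemma paired_array_append_columns:
  assumes "paired_array m n A" "paired_array m n' B"
  shows "\<exists>C. paired_array m (n + n') C"
proof -
  define c where "c = int (m * n div 2)"
  define C where "C = (\<lambda>i j. if j < n then A i j else shift c (B i (j - n)))"
  \<comment> \<open>The halves add up exactly because both products are even.\<close>
  have c: "0 \<le> c" "int (m * (n + n') div 2) = c + int (m * n' div 2)"
    using assms by (auto simp: c_def paired_array_def distrib_left elim!: evenE)
  have rows: "balanced (n + n') (C i)" if "i < m" for i
    using that assms c(1) unfolding C_def paired_array_def
    by (intro balanced_append balanced_shift) auto
  have cols: "balanced m (\<lambda>i. C i j)" if "j < n + n'" for j
    using that assms c(1) unfolding C_def paired_array_def
    by (cases "j < n") (auto intro!: balanced_shift)
  have entries: "\<exists>i<m. (\<exists>j<n + n'. C i j = x) \<and> (\<exists>j<n + n'. C i j = - x)"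
    if x: "1 \<le> x" "x \<le> int (m * (n + n') div 2)" for x
  proof (cases "x \<le> c")
    case True
    with x obtain i j k where "i < m" "j < n" "A i j = x" "k < n" "A i k = - x"
      using paired_array_entries[OF assms(1), of x] unfolding c_def by metis
    then have "i < m" "j < n + n'" "C i j = x" "k < n + n'" "C i k = - x"
      by (auto simp: C_def)
    then show ?thesis by blast
  next
    case False
    then have "1 \<le> x - c" "x - c \<le> int (m * n' div 2)"
      using x c by auto
    then obtain i j k where "i < m" "j < n'" "B i j = x - c" "k < n'" "B i k = - (x - c)"
      using paired_array_entries[OF assms(2), of "x - c"] by metis
    then have "i < m" "n + j < n + n'" "C i (n + j) = x" "n + k < n + n'" "C i (n + k) = - x"
      using False by (auto simp: C_def shift_def)
    then show ?thesis by blast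
  qed
  have "paired_array m (n + n') C"
    using assms rows cols entries by (auto simp: paired_array_def)
  then show ?thesis by blast
qed

lemma paired_array_append_rows:
  assumes "paired_array m n A" "paired_array m' n B"
  shows "\<exists>C. paired_array (m + m') n C"
proof -
  define c where "c = int (m * n div 2)"
  define C where "C = (\<lambda>i j. if i < m then A i j else shift c (B (i - m) j))"
  have c: "0 \<le> c" "int ((m + m') * n div 2) = c + int (m' * n div 2)"
    using assms by (auto simp: c_def paired_array_def distrib_right elim!: evenE)
  have rows: "balanced n (C i)" if "i < m + m'" for i
    using that assms c(1) unfolding C_def paired_array_def
    by (cases "i < m") (auto intro!: balanced_shift)
  have cols: "balanced (m + m') (\<lambda>i. C i j)" if "j < n" for j
    using that assms c(1) unfolding C_def paired_array_def
    \<comment> \<open>Here the columns are the concatenated sequences; \<open>g\<close> is column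
      \<open>j\<close> of the shifted \<open>B\<close>.\<close>
    by (intro balanced_append[where g = "\<lambda>i. shift c (B i j)"] balanced_shift) auto
  have entries: "\<exists>i<m + m'. (\<exists>j<n. C i j = x) \<and> (\<exists>j<n. C i j = - x)"
    if x: "1 \<le> x" "x \<le> int ((m + m') * n div 2)" for x
  proof (cases "x \<le> c")
    case True
    with x obtain i j k where "i < m" "j < n" "A i j = x" "k < n" "A i k = - x"
      using paired_array_entries[OF assms(1), of x] unfolding c_def by metis
    then have "i < m + m'" "j < n" "C i j = x" "k < n" "C i k = - x"
      by (auto simp: C_def)
    then show ?thesis by blast
  next
    case False
    then have "1 \<le> x - c" "x - c \<le> int (m' * n div 2)"
      using x c by auto
    then obtain i j k where "i < m'" "j < n" "B i j = x - c" "k < n" "B i k = - (x - c)"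
      using paired_array_entries[OF assms(2), of "x - c"] by metis
    then have "m + i < m + m'" "j < n" "C (m + i) j = x" "k < n" "C (m + i) k = - x"
      using False by (auto simp: C_def shift_def)
    then show ?thesis by blast
  qed
  have "paired_array (m + m') n C"
    using assms rows cols entries by (auto simp: paired_array_def)
  then show ?thesis by blast
qed

text \<open>Recasts the conditions over explicit lists, so that simplification can decide them for a
  concrete array.\<close>

lemma paired_array_check:
  assumes "int (m * n) = 2 * N"
    and "\<forall>i\<in>set [0..<m]. balanced n (A i)" "\<forall>j\<in>set [0..<n]. balanced m (\<lambda>i. A i j)"
    and "list_all (\<lambda>x. \<exists>i\<in>set [0..<m]. x \<in> A i ` set [0..<n] \<and> - x \<in> A i ` set [0..<n]) [1..N]"
  shows "paired_array m n A"
proof -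
  have "(\<exists>j<n. A i j = y) \<longleftrightarrow> y \<in> A i ` set [0..<n]" for i y
    by auto
  moreover have "even (m * n)" "N = int (m * n div 2)"
    using assms(1) by presburger+
  ultimately show ?thesis
    using assms(2-4) by (simp add: paired_array_def list_all_iff Ball_def Bex_def)
qed

text \<open>The columns are opposite, so only 1 - 2 - 3 + 4 = 0 matters.\<close>

lemma paired_array_4_2:
  "paired_array 4 2 (\<lambda>i j. [[1, -1], [-2, 2], [-3, 3], [4, -4]] ! i ! j)"
  by (rule paired_array_check[where N = 4])
    (simp_all add: balanced_def upt_rec upto_rec1 numeral_eq_Suc lessThan_Suc)

text \<open>Two pairs of opposite columns: their absolute values split 1, ..., 12 into sets with the
  even sums 40 and 38.\<close>

lemma paired_array_6_4:
  "paired_array 6 4 (\<lambda>i j.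
     [[ -1,   1, -2,   2],
      [  4,  -4,  3,  -3],
      [  6,  -6,  5,  -5],
      [ -7,   7, -8,   8],
      [ 10, -10, -9,   9],
      [-12,  12, 11, -11]] ! i ! j)"
  by (rule paired_array_check[where N = 12])
    (simp_all add: balanced_def upt_rec upto_rec1 numeral_eq_Suc lessThan_Suc)

text \<open>Three pairs of opposite columns are impossible: each would use absolute values of even
  sum, but 1 + ... + 18 = 171 is odd. Hence the pairs are spread over the columns differently from
  row to row.\<close>

lemma paired_array_6_6:
  "paired_array 6 6 (\<lambda>i j.
     [[  3,  -2,   2,   1,  -3,  -1],
      [ -5,   4,  -4,  -6,   6,   5],
      [  9,  -8,  -7,  -9,   7,   8],
      [-11,  10,  12,  11, -12, -10],
      [-13,  14,  13, -15, -14,  15],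
      [ 17, -18, -16,  18,  16, -17]] ! i ! j)"
  by (rule paired_array_check[where N = 18])
    (simp_all add: balanced_def upt_rec upto_rec1 numeral_eq_Suc lessThan_Suc)

lemma ex_paired_array_4: "\<exists>A. paired_array 4 (2 * k + 4) A"
proof (induction k)
  case 0
  show ?case
    using paired_array_append_columns[OF paired_array_4_2 paired_array_4_2] by simp
next
  case (Suc k)
  then obtain A where "paired_array 4 (2 * k + 4) A" by blast
  from paired_array_append_columns[OF this paired_array_4_2] show ?case
    by (simp add: algebra_simps)
qed

text \<open>Blocks of four columns raise \<open>k\<close> by 2, hence the two base widths 4 and
  6.\<close>

lemma ex_paired_array_6: "\<exists>A. paired_array 6 (2 * k + 4) A"
proof (induction k rule: induct_nat_012)
  case 0
  show ?case using paired_array_6_4 by auto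
next
  case 1
  show ?case using paired_array_6_6 by auto
next
  case (ge2 k)
  then obtain A where "paired_array 6 (2 * k + 4) A" by blast
  from paired_array_append_columns[OF this paired_array_6_4] show ?case
    by (simp add: algebra_simps)
qed

lemma ex_paired_array: "\<exists>A. paired_array (2 * h + 4) (2 * k + 4) A"
\<comment> \<open>Four rows are added at a time, starting from heights 4 and 6.\<close>
proof (induction h rule: induct_nat_012)
  case 0
  show ?case using ex_paired_array_4[of k] by simp
next
  case 1
  show ?case using ex_paired_array_6[of k] by simp
next
  case (ge2 h)
  then obtain A where A: "paired_array (2 * h + 4) (2 * k + 4) A" by blast
  obtain B where B: "paired_array 4 (2 * k + 4) B"
    using ex_paired_array_4 by blast
  from paired_array_append_rows[OF A B] show ?case
    by (simp add: algebra_simps)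
qed

lemma card_sma_entries:
  assumes "even (m * n)"
  shows "finite (sma_entries m n)" "card (sma_entries m n) = m * n"
proof -
  let ?N = "int (m * n div 2)"
  have eq: "sma_entries m n = {1..?N} \<union> {- ?N..- 1}"
    by (auto simp: sma_entries_def)
  show "finite (sma_entries m n)"
    by (simp add: eq)
  have "card (sma_entries m n) = card {1..?N} + card {- ?N..- 1}"
    unfolding eq by (rule card_Un_disjoint) auto
  also have "\<dots> = 2 * (m * n div 2)"
    by simp
  finally show "card (sma_entries m n) = m * n"
    using assms by simp
qed

text \<open>Since there are as many cells as admissible entries, covering all entries already forces
  the array to be a bijection.\<close>

lemma paired_array_imp_SMA:
  assumes A: "paired_array m n A" and "m > 0" "n > 0"
  shows "SMA m n A"
proof -
  let ?f = "\<lambda>(i, j). A i j" and ?S = "{..<m} \<times> {..<n}"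
  have ev: "even (m * n)"
    using A by (simp add: paired_array_def)
  have sub: "sma_entries m n \<subseteq> ?f ` ?S"
  proof
    fix x assume "x \<in> sma_entries m n"
    then have "1 \<le> \<bar>x\<bar>" "\<bar>x\<bar> \<le> int (m * n div 2)"
      by (simp_all add: sma_entries_def)
    with A obtain i j k where "i < m" "j < n" "A i j = \<bar>x\<bar>" "k < n" "A i k = - \<bar>x\<bar>"
      by (rule paired_array_entries)
    \<comment> \<open>\<open>x\<close> is one of the two entries found, according to its
      sign.\<close>
    then have "\<exists>j<n. A i j = x"
      by (cases "x \<ge> 0") auto
    with \<open>i < m\<close> show "x \<in> ?f ` ?S"
      by force
  qed
  have "card (?f ` ?S) \<le> card (sma_entries m n)"
    using card_image_le[of ?S ?f] card_sma_entries(2)[OF ev] by simp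
  with sub have img: "?f ` ?S = sma_entries m n"
    by (intro card_seteq[symmetric]) simp_all
  then have "inj_on ?f ?S"
    using card_sma_entries(2)[OF ev] by (intro eq_card_imp_inj_on) simp_all
  with img A assms(2,3) show ?thesis
    by (simp add: SMA_def bij_betw_def paired_array_def balanced_def)
qed

theorem theorem2p1:
  fixes m n :: nat
  assumes "even m" and "even n" and "m \<ge> 4" and "n \<ge> 4"
  shows "\<exists>A. SMA m n A \<and> shiftable m n A \<and>
           (\<forall>x \<in> {1..int (m * n div 2)}.
              \<exists>i<m. (\<exists>j<n. A i j = x) \<and> (\<exists>j<n. A i j = - x))"
proof -
  have "m = 2 * ((m - 4) div 2) + 4" "n = 2 * ((n - 4) div 2) + 4"
    using assms by (auto elim!: evenE)
  then obtain A where A: "paired_array m n A"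
    using ex_paired_array by metis
  then have "SMA m n A"
    using assms by (intro paired_array_imp_SMA) auto
  moreover have "shiftable m n A"
    using A balanced_signs unfolding shiftable_def paired_array_def by blast
  ultimately show ?thesis
    using A unfolding paired_array_def by blast
qed

end
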